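(* Let $G$ and $H$ be graphs with roots $R_G\subseteq G$ and $R_H\subseteq H$, and let $G$ be connected. Let $d_{R_G}=d(R_G,Res(G,R_G))$ and $d_{R_H}=d(R_H,Res(H,R_H))$, and let $H\setminus\langle V_0\cup V_1\rangle_H$ denote the subgraph of $H$ obtained by deleting the vertices of $R_H$ and the vertices of $H$ adjacent to $R_H$ (the first two classes of the distance partition of $H$ with respect to $V(R_H)$). Call $r_G\in V(R_G)$ isolated if it is an isolated vertex of $R_G$. Then $Res(G\circ H,\;R_G\circ R_H)$ is isomorphic to: 1. $\bigcup_{r_G\in V(R_G),\,r_G \text{ isolated}}\big(H\setminus\langle V_0\cup V_1\rangle_H\big)$ (one copy for each isolated vertex of $R_G$), if $d_{R_G}=1$, $d_{R_H}\neq 1$ and $R_G$ has isolated vertices; 2. $(G\circ H)\setminus(R_G\circ R_H)$, if $d_{R_G}=1$ and ($d_{R_H}=1$ or $R_G$ has no isolated vertices); 3. $Res(G,R_G)\circ H\;\cup\;\bigcup_{r_G\in V(R_G),\,r_G\text{ isolated}}\big(H\setminus\langle V_0\cup V_1\rangle_H\big)$, if $d_{R_G}=2$; 4. $Res(G,R_G)\circ H$, if $d_{R_G}\ge 3$.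
   Context: A root of a graph $G$ is an induced subgraph $R_G=\langle V_0\rangle$ on a nonempty vertex set $V_0$; with $V_i$ the set of vertices at distance exactly $i$ from $V_0$ and $r$ the largest $i$ with $V_i\ne\emptyset$, the distance-residual graph is $Res(G,R_G)=\langle V_r\rangle$ and $d_{R_G}=d(R_G,Res(G,R_G))=r$. $G\circ H$ is the lexicographic product: vertex set $V(G)\times V(H)$, with $(u,x)\sim(v,y)$ iff $uv\in E(G)$, or ($u=v$ and $xy\in E(H)$). $R_G\circ R_H$ is the subgraph of $G\circ H$ induced on $V(R_G)\times V(R_H)$. In cases 1 and 3, the graphs listed are understood as the induced subgraphs of $G\circ H$ on the corresponding vertex sets ($\{r_G\}\times V(H\setminus\langle V_0\cup V_1\rangle_H)$ for each isolated $r_G$, and $V(Res(G,R_G))\times V(H)$); $(G\circ H)\setminus(R_G\circ R_H)$ denotes $G\circ H$ with the vertices of $R_G\circ R_H$ removed.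
   Formalization: Case 1 additionally assumes V(R_H) ≠ V(H) (it fails for H = R_H), and vertices of H unreachable from R_H are given distance infinity, so that then d_{R_H} = ∞ (with only finite distances case 2 fails for disconnected H). *)

theory Defs
  imports "Graph_Theory.Graph_Theory" "HOL-Library.Extended_Nat"
begin

text \<open>Undirected graphs are symmetric digraphs, as in the library. The library locale
  \<^locale>\<open>graph\<close> is this one together with finiteness.\<close>

locale simple_graph = loopfree_digraph + nomulti_digraph + sym_digraph

definition is_root :: "('a, 'b) pre_digraph \<Rightarrow> ('a, 'b) pre_digraph \<Rightarrow> bool" where
  "is_root R G \<longleftrightarrow> induced_subgraph R G \<and> verts R \<noteq> {}"

definition gdist :: "('a, 'b) pre_digraph \<Rightarrow> 'a \<Rightarrow> 'a \<Rightarrow> enat" where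
  "gdist G u v = (INF p \<in> {p. pre_digraph.awalk G u p v}. enat (length p))"

definition set_dist :: "('a, 'b) pre_digraph \<Rightarrow> 'a set \<Rightarrow> 'a \<Rightarrow> enat" where
  "set_dist G S v = (INF u \<in> S. gdist G u v)"

text \<open>Distances are extended naturals: vertices that cannot be reached from \<open>S\<close> form the
  class with index \<open>\<infinity>\<close>.\<close>

definition distance_class :: "('a, 'b) pre_digraph \<Rightarrow> 'a set \<Rightarrow> enat \<Rightarrow> 'a set" where
  "distance_class G S i = {v \<in> verts G. set_dist G S v = i}"

text \<open>The supremum is the largest index of a nonempty class whenever there is one, in
  particular in every finite graph (lemma \<open>res_dist_attained\<close> below). It is \<open>\<infinity>\<close> if some vertex
  is not reachable from the root.\<close>

definition res_dist :: "('a, 'b) pre_digraph \<Rightarrow> ('a, 'b) pre_digraph \<Rightarrow> enat" where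
  "res_dist G R = Sup {i. distance_class G (verts R) i \<noteq> {}}"

definition Res :: "('a, 'b) pre_digraph \<Rightarrow> ('a, 'b) pre_digraph \<Rightarrow> ('a, 'b) pre_digraph" where
  "Res G R = G \<restriction> distance_class G (verts R) (res_dist G R)"

definition lexicographic_prod :: "('a, 'b) pre_digraph \<Rightarrow> ('c, 'd) pre_digraph
    \<Rightarrow> ('a \<times> 'c, ('a \<times> 'c) \<times> ('a \<times> 'c)) pre_digraph" where
  "lexicographic_prod G H = with_proj
    \<lparr> pverts = verts G \<times> verts H,
      parcs = {((u, x), (v, y)) | u x v y.
        u \<in> verts G \<and> v \<in> verts G \<and> x \<in> verts H \<and> y \<in> verts H \<and>
        (u \<rightarrow>\<^bsub>G\<^esub> v \<or> u = v \<and> x \<rightarrow>\<^bsub>H\<^esub> y)} \<rparr>"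

definition del_verts :: "('a, 'b) pre_digraph \<Rightarrow> 'a set \<Rightarrow> ('a, 'b) pre_digraph" where
  "del_verts G S = G \<restriction> (verts G - S)"

definition isolated_verts :: "('a, 'b) pre_digraph \<Rightarrow> 'a set" where
  "isolated_verts G = {v \<in> verts G. \<forall>w. \<not> v \<rightarrow>\<^bsub>G\<^esub> w \<and> \<not> w \<rightarrow>\<^bsub>G\<^esub> v}"

definition outer_part :: "('a, 'b) pre_digraph \<Rightarrow> ('a, 'b) pre_digraph \<Rightarrow> ('a, 'b) pre_digraph" where
  "outer_part H R = del_verts H (distance_class H (verts R) 0 \<union> distance_class H (verts R) 1)"

text \<open>The copy of \<^term>\<open>outer_part H R_H\<close> that belongs to an isolated vertex \<open>r\<close> of \<open>R_G\<close> is the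
  subgraph of the product induced on \<open>{r} \<times> verts (outer_part H R_H)\<close>. The graph argument of
  \<^const>\<open>pre_digraph.Union\<close> only supplies the tail and head functions.\<close>

definition outer_copies :: "('a, 'b) pre_digraph \<Rightarrow> ('a, 'b) pre_digraph
    \<Rightarrow> ('c, 'd) pre_digraph \<Rightarrow> ('c, 'd) pre_digraph
    \<Rightarrow> ('a \<times> 'c, ('a \<times> 'c) \<times> ('a \<times> 'c)) pre_digraph" where
  "outer_copies G R_G H R_H = pre_digraph.Union (lexicographic_prod G H)
    ((\<lambda>r. lexicographic_prod G H \<restriction> ({r} \<times> verts (outer_part H R_H))) ` isolated_verts R_G)"

definition root_prod :: "('a, 'b) pre_digraph \<Rightarrow> ('a, 'b) pre_digraph
    \<Rightarrow> ('c, 'd) pre_digraph \<Rightarrow> ('c, 'd) pre_digraph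
    \<Rightarrow> ('a \<times> 'c, ('a \<times> 'c) \<times> ('a \<times> 'c)) pre_digraph" where
  "root_prod G R_G H R_H = lexicographic_prod G H \<restriction> (verts R_G \<times> verts R_H)"

lemma simple_graph_finite_iff:
  "graph G \<longleftrightarrow> simple_graph G \<and> finite (verts G) \<and> finite (arcs G)"
  by (auto simp: graph_def digraph_def pseudo_graph_def simple_graph_def fin_digraph_def
      fin_digraph_axioms_def loopfree_digraph_def)

lemma res_dist_attained:
  assumes "finite (verts G)" "verts G \<noteq> {}"
  shows "distance_class G (verts R) (res_dist G R) \<noteq> {}"
proof -
  let ?I = "{i. distance_class G (verts R) i \<noteq> {}}"
  have I: "?I = set_dist G (verts R) ` verts G"
    by (auto simp: distance_class_def)
  have "finite ?I" "?I \<noteq> {}"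
    using assms by (simp_all add: I)
  then have "Sup ?I \<in> ?I"
    by (metis Max_in Max_Sup)
  then show ?thesis
    by (simp add: res_dist_def)
qed

text \<open>The distance is the library's shortest-path cost for unit arc weights.\<close>

lemma gdist_eq_unit_cost:
  assumes "wf_digraph G"
  shows "ereal_of_enat (gdist G u v) = wf_digraph.\<mu> G (\<lambda>_. 1) u v"
proof -
  have cost: "wf_digraph.awalk_cost (\<lambda>_. 1) p = real (length p)" for p :: "'b list"
    by (induction p) (simp_all add: wf_digraph.awalk_cost_def[OF assms])
  have INF: "ereal_of_enat (INF p \<in> A. enat (length p)) = (INF p \<in> A. ereal (real (length p)))"
    for A :: "'b list set"
  proof (cases "A = {}")
    case True
    then show ?thesis
      by (simp add: top_ereal_def top_enat_def)
  next
    case False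
    let ?B = "(\<lambda>p. enat (length p)) ` A"
    have "Inf ?B \<in> ?B"
      using False by (metis Inf_enat_def LeastI_ex ex_in_conv image_is_empty)
    then obtain q where q: "q \<in> A" "Inf ?B = enat (length q)"
      by auto
    have "length q \<le> length p" if "p \<in> A" for p
      using that q(2) by (metis INF_lower enat_ord_simps(1))
    then have "(INF p \<in> A. ereal (real (length p))) = ereal (real (length q))"
      using q(1) by (intro INF_eqI) auto
    then show ?thesis
      by (simp add: q(2))
  qed
  show ?thesis
    by (simp add: gdist_def wf_digraph.\<mu>_def[OF assms] cost INF)
qed

lemma root_prod_eq:
  assumes "induced_subgraph R_G G" "induced_subgraph R_H H"
  shows "root_prod G R_G H R_H = lexicographic_prod R_G R_H"
proof -
  have "u \<rightarrow>\<^bsub>R_G\<^esub> v \<longleftrightarrow> u \<rightarrow>\<^bsub>G\<^esub> v" if "u \<in> verts R_G" "v \<in> verts R_G" for u v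
    using assms(1) that
    by (fastforce simp: induced_subgraph_def subgraph_def compatible_def arcs_ends_def arc_to_ends_def)
  moreover have "x \<rightarrow>\<^bsub>R_H\<^esub> y \<longleftrightarrow> x \<rightarrow>\<^bsub>H\<^esub> y" if "x \<in> verts R_H" "y \<in> verts R_H" for x y
    using assms(2) that
    by (fastforce simp: induced_subgraph_def subgraph_def compatible_def arcs_ends_def arc_to_ends_def)
  moreover have "verts R_G \<subseteq> verts G" "verts R_H \<subseteq> verts H"
    using assms by (auto simp: induced_subgraph_def subgraph_def)
  ultimately show ?thesis
    by (auto simp: root_prod_def lexicographic_prod_def induce_subgraph_def with_proj_def)
qed

end

theory Submission
  imports Defs
begin

text \<open>The distance from a set is the only function that vanishes exactly on the set, grows by at
  most 1 along each arc, and takes at some in-neighbour of each vertex of positive finite value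
  the value one less. This determines the distance of \<open>(v, y)\<close> from \<open>R_G \<circ> R_H\<close>: it is the distance
  of \<open>v\<close> from \<open>R_G\<close> if \<open>v\<close> lies outside \<open>R_G\<close>, it is at most 1 if \<open>v\<close> has a neighbour in \<open>R_G\<close>, and
  over an isolated vertex of \<open>R_G\<close> it is the distance of \<open>y\<close> from \<open>R_H\<close> truncated at 2, because one
  can leave the fibre to a neighbour of \<open>v\<close> in \<open>G\<close> and return. In each of the four cases the
  residual graph then even equals the graph it is claimed to be isomorphic to.\<close>

section \<open>Distance from a set of vertices\<close>

lemma enat_less_Suc_iff: "x < enat (Suc n) \<longleftrightarrow> x \<le> enat n"
  by (cases x) auto

lemma set_dist_le_iff:
  "set_dist G S v \<le> enat n \<longleftrightarrow> (\<exists>u\<in>S. \<exists>p. pre_digraph.awalk G u p v \<and> length p \<le> n)"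
  \<comment> \<open>A strict bound on an infimum hands over a walk that meets it
    (\<open>INF_less_iff\<close>), so \<open>\<le> n\<close> is traded for
    \<open>< Suc n\<close>.\<close>
  unfolding enat_less_Suc_iff[symmetric]
  by (auto simp: set_dist_def gdist_def INF_less_iff less_Suc_eq_le)

lemma (in wf_digraph) set_dist_eq_0_iff:
  assumes "S \<subseteq> verts G"
  shows "set_dist G S v = 0 \<longleftrightarrow> v \<in> S"
  using assms set_dist_le_iff[of G S v 0]
  by (auto simp: awalk_Nil_iff zero_enat_def[symmetric])

lemma (in wf_digraph) set_dist_dominates_le:
  assumes "v \<rightarrow>\<^bsub>G\<^esub> w"
  shows "set_dist G S w \<le> set_dist G S v + 1"
proof (cases "set_dist G S v")
  case (enat n)
  then obtain u p where u: "u \<in> S" and p: "awalk u p v" "length p \<le> n"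
    using set_dist_le_iff[of G S v n] by auto
  obtain a where "a \<in> arcs G" "tail G a = v" "head G a = w"
    using assms by (auto simp: arcs_ends_def arc_to_ends_def)
  then have "awalk v [a] w"
    by (auto simp: awalk_simps)
  with p(1) have "awalk u (p @ [a]) w"
    by (rule awalk_appendI)
  moreover have "length (p @ [a]) \<le> Suc n"
    using p(2) by simp
  ultimately have "set_dist G S w \<le> enat (Suc n)"
    unfolding set_dist_le_iff using u by blast
  then show ?thesis
    by (simp add: enat one_enat_def)
qed simp

text \<open>Cut the last arc off a shortest walk: its tail has distance at most \<open>n\<close>,
  and \<open>set_dist_dominates_le\<close> excludes anything smaller.\<close>

lemma (in wf_digraph) set_dist_SucE:
  assumes "S \<subseteq> verts G" and w: "set_dist G S w = enat (Suc n)"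
  obtains v where "v \<rightarrow>\<^bsub>G\<^esub> w" "set_dist G S v = enat n"
proof -
  obtain u p where u: "u \<in> S" and p: "awalk u p w" "length p \<le> Suc n"
    using w set_dist_le_iff[of G S w "Suc n"] by auto
  have "p \<noteq> []"
    using u p(1) w set_dist_eq_0_iff[OF assms(1), of w] by (auto simp: awalk_Nil_iff zero_enat_def)
  then obtain q a where q: "p = q @ [a]"
    by (cases p rule: rev_cases) auto
  then have *: "awalk u q (tail G a)" "a \<in> arcs G" "head G a = w"
    using p(1) by (auto simp: awalk_simps)
  then have dom: "tail G a \<rightarrow>\<^bsub>G\<^esub> w"
    by (auto simp: arcs_ends_def arc_to_ends_def)
  have "set_dist G S (tail G a) \<le> enat n"
    using u *(1) p(2) q by (auto simp: set_dist_le_iff)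
  moreover have "enat (Suc n) \<le> set_dist G S (tail G a) + 1"
    using set_dist_dominates_le[OF dom, of S] w by simp
  ultimately have "set_dist G S (tail G a) = enat n"
    by (cases "set_dist G S (tail G a)") (auto simp: one_enat_def)
  with dom show thesis
    by (rule that)
qed

text \<open>Descending by \<open>pred\<close> to value 0 bounds the distance by \<open>f\<close>;
  applying \<open>step\<close> along a shortest walk bounds \<open>f\<close> by the distance. Each
  induction runs over finite values of the upper bound, since an infinite bound is trivial.\<close>

lemma (in wf_digraph) set_dist_eqI:
  assumes "S \<subseteq> verts G"
    and zero: "\<And>v. v \<in> verts G \<Longrightarrow> f v = 0 \<longleftrightarrow> v \<in> S"
    and step: "\<And>v w. v \<rightarrow>\<^bsub>G\<^esub> w \<Longrightarrow> f w \<le> f v + 1"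
    and pred: "\<And>w n. w \<in> verts G \<Longrightarrow> f w = enat (Suc n) \<Longrightarrow> \<exists>v. v \<rightarrow>\<^bsub>G\<^esub> w \<and> f v = enat n"
    and "v \<in> verts G"
  shows "set_dist G S v = f v"
proof (rule antisym)
  have "set_dist G S v \<le> enat n" if "f v = enat n" "v \<in> verts G" for n v
    using that
  proof (induction n arbitrary: v)
    case 0
    then show ?case
      using zero[of v] set_dist_eq_0_iff[OF assms(1), of v] by (simp add: zero_enat_def)
  next
    case (Suc n)
    then obtain u where u: "u \<rightarrow>\<^bsub>G\<^esub> v" "f u = enat n"
      using pred by blast
    have "set_dist G S u \<le> enat n"
      using Suc.IH u adj_in_verts by blast
    then have "set_dist G S u + 1 \<le> enat (Suc n)"
      by (cases "set_dist G S u") (auto simp: one_enat_def)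
    then show ?case
      using set_dist_dominates_le[OF u(1), of S] by (rule order_trans[rotated])
  qed
  then show "set_dist G S v \<le> f v"
    using assms(5) by (cases "f v") auto
  have "f v \<le> enat n" if "set_dist G S v = enat n" "v \<in> verts G" for n v
    using that
  proof (induction n arbitrary: v)
    case 0
    then show ?case
      using zero[of v] set_dist_eq_0_iff[OF assms(1), of v] by (simp add: zero_enat_def)
  next
    case (Suc n)
    then obtain u where u: "u \<rightarrow>\<^bsub>G\<^esub> v" "set_dist G S u = enat n"
      using set_dist_SucE[OF assms(1)] by blast
    have "f u \<le> enat n"
      using Suc.IH u adj_in_verts by blast
    then have "f u + 1 \<le> enat (Suc n)"
      by (cases "f u") (auto simp: one_enat_def)
    then show ?case
      using step[OF u(1)] by (rule order_trans[rotated])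
  qed
  then show "f v \<le> set_dist G S v"
    using assms(5) by (cases "set_dist G S v") auto
qed

section \<open>The largest distance from a root\<close>

lemma res_dist_eq_SUP: "res_dist G R = (SUP v\<in>verts G. set_dist G (verts R) v)"
proof -
  have "{i. distance_class G (verts R) i \<noteq> {}} = set_dist G (verts R) ` verts G"
    by (auto simp: distance_class_def)
  then show ?thesis
    by (simp add: res_dist_def)
qed

lemma set_dist_le_res_dist: "v \<in> verts G \<Longrightarrow> set_dist G (verts R) v \<le> res_dist G R"
  by (simp add: res_dist_eq_SUP SUP_upper)

lemma res_dist_eqI:
  assumes "\<And>v. v \<in> verts G \<Longrightarrow> set_dist G (verts R) v \<le> d"
    and "w \<in> verts G" "set_dist G (verts R) w = d"
  shows "res_dist G R = d"
  using assms unfolding res_dist_eq_SUP by (intro antisym SUP_least SUP_upper2[of w]) auto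

text \<open>A finite positive supremum is attained even in an infinite graph: some vertex exceeds
  \<open>n\<close> and none exceeds \<open>Suc n\<close>.\<close>

lemma res_dist_SucE:
  assumes "res_dist G R = enat (Suc n)"
  obtains v where "v \<in> verts G" "set_dist G (verts R) v = enat (Suc n)"
proof -
  have "\<not> res_dist G R \<le> enat n"
    by (simp add: assms)
  then obtain v where v: "v \<in> verts G" "\<not> set_dist G (verts R) v \<le> enat n"
    unfolding res_dist_eq_SUP SUP_le_iff by blast
  moreover have "set_dist G (verts R) v \<le> enat (Suc n)"
    using set_dist_le_res_dist[OF v(1), of R] by (simp add: assms)
  ultimately show thesis
    using that by (cases "set_dist G (verts R) v") auto
qed

section \<open>Induced subgraphs of lexicographic products\<close>

lemma wf_digraph_induce:
  assumes "wf_digraph G"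
  shows "wf_digraph (G \<restriction> A)"
  using assms by unfold_locales auto

lemma digraph_iso_refl:
  assumes "wf_digraph G"
  shows "digraph_iso G G"
  unfolding digraph_iso_def
  by (rule exI[of _ "\<lparr>iso_verts = id, iso_arcs = id, iso_head = head G, iso_tail = tail G\<rparr>"])
    (simp add: pre_digraph.digraph_isomorphism_def app_iso_def assms)

text \<open>Inducing on \<open>A \<union> B\<close> could only add arcs between \<open>A\<close> and
  \<open>B\<close>, and there are none.\<close>

lemma union_induce:
  assumes "\<And>u v. u \<in> A \<Longrightarrow> v \<in> B \<Longrightarrow> \<not> u \<rightarrow>\<^bsub>G\<^esub> v \<and> \<not> v \<rightarrow>\<^bsub>G\<^esub> u"
  shows "union (G \<restriction> A) (G \<restriction> B) = G \<restriction> (A \<union> B)"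
  using assms
  by (fastforce simp: union_def induce_subgraph_def arcs_ends_def arc_to_ends_def)

lemma Union_induce:
  assumes "\<And>i j u v. i \<in> I \<Longrightarrow> j \<in> I \<Longrightarrow> i \<noteq> j \<Longrightarrow> u \<in> A i \<Longrightarrow> v \<in> A j \<Longrightarrow> \<not> u \<rightarrow>\<^bsub>G\<^esub> v"
  shows "pre_digraph.Union G ((\<lambda>i. G \<restriction> A i) ` I) = G \<restriction> (\<Union>i\<in>I. A i)"
  using assms
  by (fastforce simp: pre_digraph.Union_def induce_subgraph_def arcs_ends_def arc_to_ends_def)

lemma verts_lexicographic_prod [simp]: "verts (lexicographic_prod G H) = verts G \<times> verts H"
  by (simp add: lexicographic_prod_def)

lemma dominates_lexicographic_prod_iff:
  "(u, x) \<rightarrow>\<^bsub>lexicographic_prod G H\<^esub> (v, y) \<longleftrightarrow>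
    u \<in> verts G \<and> v \<in> verts G \<and> x \<in> verts H \<and> y \<in> verts H \<and> (u \<rightarrow>\<^bsub>G\<^esub> v \<or> u = v \<and> x \<rightarrow>\<^bsub>H\<^esub> y)"
  by (auto simp: lexicographic_prod_def arcs_ends_def arc_to_ends_def)

lemma wf_digraph_lexicographic_prod: "wf_digraph (lexicographic_prod G H)"
  by unfold_locales (auto simp: lexicographic_prod_def)

lemma dominates_induce_iff: "u \<rightarrow>\<^bsub>G \<restriction> A\<^esub> v \<longleftrightarrow> u \<in> A \<and> v \<in> A \<and> u \<rightarrow>\<^bsub>G\<^esub> v"
  by (auto simp: induce_subgraph_def arcs_ends_def arc_to_ends_def)

text \<open>This is an equality of graphs because an arc of the product is the pair of its
  ends.\<close>

lemma lexicographic_prod_induce_left: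
  assumes "A \<subseteq> verts G"
  shows "lexicographic_prod (G \<restriction> A) H = lexicographic_prod G H \<restriction> (A \<times> verts H)"
  using assms unfolding lexicographic_prod_def dominates_induce_iff
  by (auto simp: with_proj_def induce_subgraph_def)

lemma induced_subgraph_dominates_iff:
  assumes "induced_subgraph R G" "u \<in> verts R" "v \<in> verts R"
  shows "u \<rightarrow>\<^bsub>R\<^esub> v \<longleftrightarrow> u \<rightarrow>\<^bsub>G\<^esub> v"
  using assms
  by (fastforce simp: induced_subgraph_def subgraph_def compatible_def arcs_ends_def arc_to_ends_def)

section \<open>Distances in a lexicographic product\<close>

text \<open>\<open>proper_G\<close> sets aside a root that spans \<open>G\<close>, where
  \<open>res_dist G R_G = 0\<close> and all four cases are vacuous. It guarantees a second vertex of
  \<open>G\<close>.\<close>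

locale rooted_lexicographic_prod =
  G: simple_graph G + H: simple_graph H
  for G :: "('a, 'b) pre_digraph" and H :: "('c, 'd) pre_digraph" +
  fixes R_G :: "('a, 'b) pre_digraph" and R_H :: "('c, 'd) pre_digraph"
  assumes root_G: "is_root R_G G" and root_H: "is_root R_H H"
    and connected_G: "connected G"
    and proper_G: "verts R_G \<noteq> verts G"
begin

abbreviation P where "P \<equiv> lexicographic_prod G H"
abbreviation R where "R \<equiv> root_prod G R_G H R_H"
abbreviation dG where "dG \<equiv> set_dist G (verts R_G)"
abbreviation dH where "dH \<equiv> set_dist H (verts R_H)"
abbreviation dP where "dP \<equiv> set_dist P (verts R)"

lemma
  shows R_G_subset: "verts R_G \<subseteq> verts G" and R_H_subset: "verts R_H \<subseteq> verts H"
    and R_G_nonempty: "verts R_G \<noteq> {}" and R_H_nonempty: "verts R_H \<noteq> {}"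
    and verts_R: "verts R = verts R_G \<times> verts R_H"
  using root_G root_H
  by (auto simp: is_root_def induced_subgraph_def subgraph_def root_prod_def)

lemma isolated_verts_subset: "isolated_verts R_G \<subseteq> verts R_G"
  by (auto simp: isolated_verts_def)

lemma isolated_not_dominates:
  assumes "v \<in> isolated_verts R_G" "w \<in> verts R_G"
  shows "\<not> v \<rightarrow>\<^bsub>G\<^esub> w" "\<not> w \<rightarrow>\<^bsub>G\<^esub> v"
proof -
  have "induced_subgraph R_G G"
    using root_G by (simp add: is_root_def)
  from induced_subgraph_dominates_iff[OF this]
  show "\<not> v \<rightarrow>\<^bsub>G\<^esub> w" "\<not> w \<rightarrow>\<^bsub>G\<^esub> v"
    using assms by (auto simp: isolated_verts_def)
qed

lemma dominates_sym: "u \<rightarrow>\<^bsub>G\<^esub> v \<Longrightarrow> v \<rightarrow>\<^bsub>G\<^esub> u"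
  using G.sym_arcs by (auto simp: symmetric_def dest: symD)

lemma not_isolated_neighbour:
  assumes "v \<in> verts R_G" "v \<notin> isolated_verts R_G"
  obtains w where "w \<in> verts R_G" "w \<rightarrow>\<^bsub>G\<^esub> v"
proof -
  obtain w where w: "v \<rightarrow>\<^bsub>R_G\<^esub> w \<or> w \<rightarrow>\<^bsub>R_G\<^esub> v"
    using assms by (auto simp: isolated_verts_def)
  have "wf_digraph R_G" and ind: "induced_subgraph R_G G"
    using root_G by (auto simp: is_root_def induced_subgraph_def subgraph_def)
  then have "w \<in> verts R_G"
    using w wf_digraph.adj_in_verts by metis
  then show thesis
    using that w assms(1) induced_subgraph_dominates_iff[OF ind] dominates_sym by blast
qed

lemma G_reachable: "u \<in> verts G \<Longrightarrow> v \<in> verts G \<Longrightarrow> u \<rightarrow>\<^sup>*\<^bsub>G\<^esub> v"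
  using G.symmetric_connected_imp_strongly_connected[OF G.sym_arcs connected_G]
  by (auto simp: strongly_connected_def)

text \<open>This is the way out of a fibre: the root is nonempty and proper, so there is a second
  vertex, and the first arc of a walk to it gives the neighbour.\<close>

lemma G_neighbour:
  assumes "v \<in> verts G"
  obtains w where "w \<rightarrow>\<^bsub>G\<^esub> v"
proof -
  obtain u where u: "u \<in> verts G" "u \<noteq> v"
    using proper_G R_G_subset R_G_nonempty assms by blast
  have "v \<rightarrow>\<^sup>*\<^bsub>G\<^esub> u"
    using G_reachable assms u(1) .
  then show thesis
    using u(2) that dominates_sym by (cases rule: G.converse_reachable_cases) auto
qed

section \<open>A closed form for the distance from the root of the product\<close>

lemma dG_eq_0_iff: "dG v = 0 \<longleftrightarrow> v \<in> verts R_G"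
  by (rule G.set_dist_eq_0_iff[OF R_G_subset])

lemma dH_eq_0_iff: "dH y = 0 \<longleftrightarrow> y \<in> verts R_H"
  by (rule H.set_dist_eq_0_iff[OF R_H_subset])

text \<open>The truncation also gives the value 2 to a vertex whose second component cannot be
  reached from \<open>R_H\<close> inside \<open>H\<close>.\<close>

definition prod_dist :: "'a \<times> 'c \<Rightarrow> enat" where
  "prod_dist = (\<lambda>(v, y).
    if v \<notin> verts R_G then dG v
    else if y \<in> verts R_H then 0
    else if v \<in> isolated_verts R_G then min 2 (dH y)
    else 1)"

lemma prod_dist_eq_0_iff: "prod_dist a = 0 \<longleftrightarrow> a \<in> verts R"
  using dG_eq_0_iff[of "fst a"] dH_eq_0_iff[of "snd a"]
  by (cases a) (auto simp: prod_dist_def verts_R min_def)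

text \<open>The delicate arcs are those of \<open>G\<close> ending in \<open>R_G\<close>. From
  inside \<open>R_G\<close>, such an arc ends at a non-isolated vertex, with value at most 1; from
  outside, it starts at value at least 1, and no value over \<open>R_G\<close> exceeds 2.\<close>

lemma prod_dist_dominates_le:
  assumes "a \<rightarrow>\<^bsub>P\<^esub> b"
  shows "prod_dist b \<le> prod_dist a + 1"
proof -
  obtain v y w z where ab: "a = (v, y)" "b = (w, z)"
    by (cases a, cases b)
  have one_le: "1 \<le> e" if "e \<noteq> 0" for e :: enat
    using that by (simp add: ileI1 one_eSuc)
  have two: "(2 :: enat) = 1 + 1"
    by simp
  consider (G) "v \<rightarrow>\<^bsub>G\<^esub> w" | (H) "v = w" "y \<rightarrow>\<^bsub>H\<^esub> z"
    using assms by (auto simp: ab dominates_lexicographic_prod_iff)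
  then show ?thesis
  proof cases
    case G
    have step: "dG w \<le> dG v + 1"
      using G by (rule G.set_dist_dominates_le)
    show ?thesis
    proof (cases "w \<in> verts R_G")
      case False
      have "dG v \<le> prod_dist a"
        using dG_eq_0_iff[of v] by (auto simp: ab prod_dist_def)
      then have "dG w \<le> prod_dist a + 1"
        using step by (meson add_right_mono order_trans)
      then show ?thesis
        using False by (simp add: ab prod_dist_def)
    next
      case True
      show ?thesis
      proof (cases "v \<in> verts R_G")
        case True
        then have "w \<notin> isolated_verts R_G"
          using G isolated_not_dominates by blast
        then have "prod_dist b \<le> 1"
          using \<open>w \<in> verts R_G\<close> by (auto simp: ab prod_dist_def)
        then show ?thesis
          by (simp add: add_increasing)
      next
        case False
        then have "1 \<le> prod_dist a"
          using dG_eq_0_iff[of v] one_le by (auto simp: ab prod_dist_def)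
        then have "2 \<le> prod_dist a + 1"
          unfolding two by (rule add_right_mono)
        moreover have "prod_dist b \<le> 2"
          using True by (auto simp: ab prod_dist_def)
        ultimately show ?thesis
          by (rule order_trans[rotated])
      qed
    qed
  next
    case H
    have step: "dH z \<le> dH y + 1"
      using H(2) by (rule H.set_dist_dominates_le)
    consider "w \<notin> verts R_G" | "w \<in> verts R_G" "w \<notin> isolated_verts R_G"
      | "w \<in> verts R_G" "w \<in> isolated_verts R_G"
      by blast
    then show ?thesis
    proof cases
      case 3
      \<comment> \<open>The formula includes second components in \<open>R_H\<close>, where
        \<open>dH\<close> is 0.\<close>
      then have "prod_dist a = min 2 (dH y)" "prod_dist b = min 2 (dH z)"
        using dH_eq_0_iff[of y] dH_eq_0_iff[of z] by (auto simp: ab H(1) prod_dist_def)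
      moreover have "min 2 (dH z) \<le> min 2 (dH y) + 1"
        using step by (cases "2 \<le> dH y") (auto simp: min_le_iff_disj min.absorb1 min.absorb2)
      ultimately show ?thesis
        by simp
    qed (auto simp: ab H(1) prod_dist_def)
  qed
qed

lemma prod_dist_pred:
  assumes "b \<in> verts P" and "prod_dist b = enat (Suc n)"
  shows "\<exists>a. a \<rightarrow>\<^bsub>P\<^esub> b \<and> prod_dist a = enat n"
proof -
  obtain v y where b: "b = (v, y)" and v: "v \<in> verts G" and y: "y \<in> verts H"
    using assms(1) by auto
  obtain x where x: "x \<in> verts R_H" "x \<in> verts H"
    using R_H_nonempty R_H_subset by blast
  show ?thesis
  proof (cases "v \<in> verts R_G")
    case False
    then have "dG v = enat (Suc n)"
      using assms(2) by (simp add: b prod_dist_def)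
    then obtain u where u: "u \<rightarrow>\<^bsub>G\<^esub> v" "dG u = enat n"
      using G.set_dist_SucE[OF R_G_subset] by blast
    \<comment> \<open>With \<open>x\<close> in \<open>R_H\<close>, the value at
      \<open>(u, x)\<close> is \<open>dG u\<close> even if \<open>u\<close> lies in
      \<open>R_G\<close>.\<close>
    then have "(u, x) \<rightarrow>\<^bsub>P\<^esub> b"
      using v y x by (auto simp: b dominates_lexicographic_prod_iff)
    moreover have "prod_dist (u, x) = enat n"
      using u(2) x dG_eq_0_iff[of u] by (auto simp: prod_dist_def)
    ultimately show ?thesis
      by blast
  next
    case vR: True
    have yR: "y \<notin> verts R_H"
      using assms(2) vR by (auto simp: b prod_dist_def zero_enat_def)
    show ?thesis
    proof (cases "v \<in> isolated_verts R_G")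
      case False
      then have n: "n = 0"
        using assms(2) vR yR by (simp add: b prod_dist_def one_enat_def)
      obtain w where w: "w \<in> verts R_G" "w \<rightarrow>\<^bsub>G\<^esub> v"
        using not_isolated_neighbour vR False by blast
      then have "(w, x) \<rightarrow>\<^bsub>P\<^esub> b" "prod_dist (w, x) = enat n"
        using v y x R_G_subset
        by (auto simp: b n dominates_lexicographic_prod_iff prod_dist_def zero_enat_def)
      then show ?thesis
        by blast
    next
      case True
      then have min: "min 2 (dH y) = enat (Suc n)"
        using assms(2) vR yR by (simp add: b prod_dist_def)
      show ?thesis
      proof (cases "2 \<le> dH y")
        case True
        then have n: "n = 1"
          using min by (simp add: min_def numeral_eq_enat)
        \<comment> \<open>The detour through \<open>G\<close>: a neighbour \<open>w\<close> of the
          isolated vertex \<open>v\<close> lies outside \<open>R_G\<close> at distance exactly 1, so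
          every vertex over \<open>w\<close> has value 1.\<close>
        obtain w where w: "w \<rightarrow>\<^bsub>G\<^esub> v"
          using G_neighbour v by blast
        then have wR: "w \<notin> verts R_G"
          using isolated_not_dominates \<open>v \<in> isolated_verts R_G\<close> by blast
        have "dG w \<le> dG v + 1"
          using G.set_dist_dominates_le dominates_sym w by blast
        then have "dG w \<le> 1"
          using dG_eq_0_iff[of v] vR by simp
        moreover have "dG w \<noteq> 0"
          using wR dG_eq_0_iff by simp
        ultimately have "dG w = enat n"
          by (cases "dG w") (auto simp: n one_enat_def zero_enat_def)
        then have "(w, y) \<rightarrow>\<^bsub>P\<^esub> b" "prod_dist (w, y) = enat n"
          using v y w wR G.adj_in_verts by (auto simp: b dominates_lexicographic_prod_iff prod_dist_def)
        then show ?thesis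
          by blast
      next
        case False
        \<comment> \<open>Here \<open>dH y = 1\<close>, and the predecessor is a root vertex in the
          same fibre.\<close>
        then have dy: "dH y = enat (Suc n)"
          using min by (simp add: min_def)
        then obtain z where z: "z \<rightarrow>\<^bsub>H\<^esub> y" "dH z = enat n"
          using H.set_dist_SucE[OF R_H_subset] by blast
        have "n = 0"
          using dy False by (simp add: numeral_eq_enat)
        then have "z \<in> verts R_H"
          using z(2) dH_eq_0_iff[of z] by (simp add: zero_enat_def)
        then have "(v, z) \<rightarrow>\<^bsub>P\<^esub> b" "prod_dist (v, z) = enat n"
          using v y z vR \<open>n = 0\<close> R_H_subset
          by (auto simp: b dominates_lexicographic_prod_iff prod_dist_def zero_enat_def)
        then show ?thesis
          by blast
      qed
    qed
  qed
qed

lemma set_dist_prod: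
  assumes "a \<in> verts P"
  shows "dP a = prod_dist a"
proof (rule wf_digraph.set_dist_eqI[where f = prod_dist, OF wf_digraph_lexicographic_prod _ _ _ _ assms])
  show "verts R \<subseteq> verts P"
    using R_G_subset R_H_subset by (auto simp: verts_R)
  show "prod_dist v = 0 \<longleftrightarrow> v \<in> verts R" for v
    by (rule prod_dist_eq_0_iff)
  show "prod_dist w \<le> prod_dist v + 1" if "v \<rightarrow>\<^bsub>P\<^esub> w" for v w
    using that by (rule prod_dist_dominates_le)
  show "\<exists>v. v \<rightarrow>\<^bsub>P\<^esub> w \<and> prod_dist v = enat n" if "w \<in> verts P" "prod_dist w = enat (Suc n)" for w n
    using that by (rule prod_dist_pred)
qed

section \<open>The residual graph of the product in the four cases\<close>

lemma outer_copies_eq: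
  "outer_copies G R_G H R_H = P \<restriction> (isolated_verts R_G \<times> verts (outer_part H R_H))"
proof -
  have "outer_copies G R_G H R_H
      = P \<restriction> (\<Union>r\<in>isolated_verts R_G. {r} \<times> verts (outer_part H R_H))"
    unfolding outer_copies_def
  proof (rule Union_induce)
    fix r s a b
    assume *: "r \<in> isolated_verts R_G" "s \<in> isolated_verts R_G" "r \<noteq> s"
      and "a \<in> {r} \<times> verts (outer_part H R_H)" "b \<in> {s} \<times> verts (outer_part H R_H)"
    \<comment> \<open>Distinct isolated vertices of the induced subgraph \<open>R_G\<close> are not
      adjacent in \<open>G\<close>, so no arc joins two copies.\<close>
    moreover have "\<not> r \<rightarrow>\<^bsub>G\<^esub> s"
      using * isolated_not_dominates isolated_verts_subset by blast
    ultimately show "\<not> a \<rightarrow>\<^bsub>P\<^esub> b"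
      by (auto simp: dominates_lexicographic_prod_iff)
  qed
  also have "(\<Union>r\<in>isolated_verts R_G. {r} \<times> verts (outer_part H R_H))
      = isolated_verts R_G \<times> verts (outer_part H R_H)"
    by auto
  finally show ?thesis .
qed

text \<open>Vertices at distance \<open>\<infinity>\<close> from \<open>R_H\<close> stay in the
  outer part.\<close>

lemma verts_outer_part: "verts (outer_part H R_H) = {y \<in> verts H. 2 \<le> dH y}"
proof -
  have "e \<noteq> 0 \<and> e \<noteq> 1 \<longleftrightarrow> 2 \<le> e" for e :: enat
    by (cases e) (auto simp: zero_enat_def one_enat_def numeral_eq_enat)
  then show ?thesis
    by (auto simp: outer_part_def del_verts_def distance_class_def)
qed

text \<open>The frame for all cases: find the supremum \<open>d\<close> of \<open>prod_dist\<close>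
  and its level set. The residual graph is then \<open>K\<close> itself, and the identity is the
  isomorphism.\<close>

lemma digraph_iso_Res_prod:
  assumes "res_dist P R = d" "{a \<in> verts P. prod_dist a = d} = A" "K = P \<restriction> A"
  shows "digraph_iso (Res P R) K"
proof -
  have "Res P R = K"
    using assms set_dist_prod by (auto simp: Res_def distance_class_def cong: conj_cong)
  moreover have "wf_digraph K"
    by (simp add: assms(3) wf_digraph_induce wf_digraph_lexicographic_prod)
  ultimately show ?thesis
    by (simp add: digraph_iso_refl)
qed

text \<open>Value 2 occurs only over isolated root vertices, since \<open>dG\<close> is at most 1.
  If \<open>R_H\<close> spanned \<open>H\<close>, the outer part would be empty, while the vertices
  over distance 1 in \<open>G\<close> would form a nonempty residual graph.\<close>

lemma Res_prod_res_dist_1_isolated: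
  assumes "res_dist G R_G = 1" "res_dist H R_H \<noteq> 1" "isolated_verts R_G \<noteq> {}"
    and "verts R_H \<noteq> verts H"
  shows "digraph_iso (Res P R) (outer_copies G R_G H R_H)"
proof -
  have dG: "dG v \<le> 1" if "v \<in> verts G" for v
    using set_dist_le_res_dist[OF that, of R_G] assms(1) by simp
  obtain r where r: "r \<in> isolated_verts R_G" "r \<in> verts R_G" "r \<in> verts G"
    using assms(3) isolated_verts_subset R_G_subset by blast
  obtain y where y: "y \<in> verts H" "2 \<le> dH y"
  \<comment> \<open>If all distances in \<open>H\<close> were at most 1, a vertex outside
    \<open>R_H\<close> would attain 1 and force \<open>res_dist H R_H = 1\<close>.\<close>
  proof (rule ccontr)
    assume "\<not> thesis"
    then have "\<not> 2 \<le> dH y" if "y \<in> verts H" for y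
      using that \<open>\<And>y. \<lbrakk>y \<in> verts H; 2 \<le> dH y\<rbrakk> \<Longrightarrow> thesis\<close> by blast
    then have le: "dH y \<le> 1" if "y \<in> verts H" for y
      using that by (cases "dH y") (force simp: one_enat_def numeral_eq_enat)+
    obtain y where y: "y \<in> verts H" "y \<notin> verts R_H"
      using assms(4) R_H_subset by blast
    then have "dH y = 1"
      using le[OF y(1)] dH_eq_0_iff[of y]
      by (cases "dH y") (auto simp: one_enat_def zero_enat_def)
    then have "res_dist H R_H = 1"
      using le y(1) by (intro res_dist_eqI)
    with assms(2) show False
      by simp
  qed
  then have yR: "y \<notin> verts R_H"
    using dH_eq_0_iff[of y] by auto
  have one_two: "(1 :: enat) \<le> 2"
    by (simp add: one_enat_def numeral_eq_enat)
  have dG2: "dG v \<le> 2" if "v \<in> verts G" for v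
    using dG[OF that] one_two by (rule order_trans)
  have "dP a \<le> 2" if "a \<in> verts P" for a
    using that dG2 one_two by (auto simp: set_dist_prod prod_dist_def)
  moreover have "dP (r, y) = 2"
    using r y yR by (simp add: set_dist_prod prod_dist_def min_def)
  ultimately have "res_dist P R = 2"
    using r y by (intro res_dist_eqI[of P R 2 "(r, y)"]) auto
  moreover have "{a \<in> verts P. prod_dist a = 2} = isolated_verts R_G \<times> verts (outer_part H R_H)"
  proof -
    have "dG v \<noteq> 2" if "v \<in> verts G" for v
      using dG[OF that] by (auto simp: one_enat_def numeral_eq_enat)
    moreover have "min 2 (dH y) = 2 \<longleftrightarrow> 2 \<le> dH y" for y
      by (auto simp: min_def)
    moreover have "y \<notin> verts R_H" if "2 \<le> dH y" for y
      using that dH_eq_0_iff[of y] by auto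
    ultimately show ?thesis
      using isolated_verts_subset R_G_subset
      by (auto simp: prod_dist_def verts_outer_part split: if_splits)
  qed
  ultimately show ?thesis
    using outer_copies_eq by (rule digraph_iso_Res_prod)
qed

text \<open>All values are 0 or 1, so the level set of 1 is the complement of the root.\<close>

lemma Res_prod_res_dist_1_no_isolated:
  assumes "res_dist G R_G = 1" "res_dist H R_H = 1 \<or> isolated_verts R_G = {}"
  shows "digraph_iso (Res P R) (del_verts P (verts R))"
proof -
  obtain v where v: "v \<in> verts G" "dG v = 1"
    using res_dist_SucE[of G R_G 0] assms(1) by (auto simp: one_enat_def)
  obtain y where y: "y \<in> verts H"
    using R_H_nonempty R_H_subset by blast
  have dG: "dG v \<le> 1" if "v \<in> verts G" for v
    using set_dist_le_res_dist[OF that, of R_G] assms(1) by simp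
  \<comment> \<open>An isolated vertex \<open>r\<close> rules out the second alternative, leaving
    \<open>res_dist H R_H = 1\<close>.\<close>
  have dH: "dH y \<le> 1" if "y \<in> verts H" "r \<in> isolated_verts R_G" for y r
    using set_dist_le_res_dist[OF that(1), of R_H] assms(2) that(2) by auto
  have le: "prod_dist a \<le> 1" if "a \<in> verts P" for a
    using that dG dH by (auto simp: prod_dist_def min_le_iff_disj)
  have "dP (v, y) = 1"
    using v y dG_eq_0_iff[of v] by (auto simp: set_dist_prod prod_dist_def)
  then have "res_dist P R = 1"
    using v y le by (intro res_dist_eqI[of P R 1 "(v, y)"]) (auto simp: set_dist_prod)
  moreover have "{a \<in> verts P. prod_dist a = 1} = verts P - verts R"
  proof -
    have "prod_dist a = 1 \<longleftrightarrow> prod_dist a \<noteq> 0" if "a \<in> verts P" for a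
      using le[OF that] by (cases "prod_dist a") (auto simp: one_enat_def zero_enat_def)
    then show ?thesis
      using prod_dist_eq_0_iff by blast
  qed
  ultimately show ?thesis
    by (rule digraph_iso_Res_prod) (simp add: del_verts_def)
qed

text \<open>Value 2 arises both outside \<open>R_G\<close>, from \<open>dG\<close>, and over
  isolated root vertices, from the truncation.\<close>

lemma Res_prod_res_dist_2:
  assumes "res_dist G R_G = 2"
  shows "digraph_iso (Res P R)
    (union (lexicographic_prod (Res G R_G) H) (outer_copies G R_G H R_H))"
proof -
  let ?D = "distance_class G (verts R_G) 2"
  obtain v where v: "v \<in> verts G" "dG v = 2"
    using res_dist_SucE[of G R_G 1] assms by (auto simp: numeral_eq_enat numeral_2_eq_2)
  obtain y where y: "y \<in> verts H"
    using R_H_nonempty R_H_subset by blast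
  have dG: "dG v \<le> 2" if "v \<in> verts G" for v
    using set_dist_le_res_dist[OF that, of R_G] assms by simp
  have one_two: "(1 :: enat) \<le> 2"
    by (simp add: one_enat_def numeral_eq_enat)
  have "dP a \<le> 2" if "a \<in> verts P" for a
    using that dG one_two by (auto simp: set_dist_prod prod_dist_def)
  moreover have "dP (v, y) = 2"
    using v y dG_eq_0_iff[of v] by (auto simp: set_dist_prod prod_dist_def)
  ultimately have "res_dist P R = 2"
    using v y by (intro res_dist_eqI[of P R 2 "(v, y)"]) auto
  moreover have "{a \<in> verts P. prod_dist a = 2}
      = ?D \<times> verts H \<union> isolated_verts R_G \<times> verts (outer_part H R_H)"
  proof -
    have "v \<notin> verts R_G" if "dG v = 2" for v
      using that dG_eq_0_iff[of v] by auto
    moreover have "min 2 (dH y) = 2 \<longleftrightarrow> 2 \<le> dH y" for y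
      by (auto simp: min_def)
    moreover have "y \<notin> verts R_H" if "2 \<le> dH y" for y
      using that dH_eq_0_iff[of y] by auto
    ultimately show ?thesis
      using isolated_verts_subset R_G_subset
      by (auto simp: prod_dist_def verts_outer_part distance_class_def split: if_splits)
  qed
  moreover have "union (lexicographic_prod (Res G R_G) H) (outer_copies G R_G H R_H)
      = P \<restriction> (?D \<times> verts H \<union> isolated_verts R_G \<times> verts (outer_part H R_H))"
  proof -
    \<comment> \<open>Distances change by at most 1 along an arc, so nothing at distance 2 is
      adjacent to a root vertex.\<close>
    have *: "\<not> r \<rightarrow>\<^bsub>G\<^esub> w" "\<not> w \<rightarrow>\<^bsub>G\<^esub> r" "w \<noteq> r" if "w \<in> ?D" "r \<in> isolated_verts R_G" for w r
    proof -
      show "\<not> r \<rightarrow>\<^bsub>G\<^esub> w" "w \<noteq> r"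
        using that G.set_dist_dominates_le[of r w "verts R_G"] isolated_verts_subset dG_eq_0_iff[of r]
        by (auto simp: distance_class_def one_enat_def numeral_eq_enat zero_enat_def)
      then show "\<not> w \<rightarrow>\<^bsub>G\<^esub> r"
        using dominates_sym by blast
    qed
    have "lexicographic_prod (Res G R_G) H = P \<restriction> (?D \<times> verts H)"
      unfolding Res_def assms
      by (rule lexicographic_prod_induce_left) (auto simp: distance_class_def)
    moreover have "\<not> a \<rightarrow>\<^bsub>P\<^esub> b \<and> \<not> b \<rightarrow>\<^bsub>P\<^esub> a"
      if "a \<in> ?D \<times> verts H" "b \<in> isolated_verts R_G \<times> verts (outer_part H R_H)" for a b
      using that *[of "fst a" "fst b"]
      by (cases a, cases b) (auto simp: dominates_lexicographic_prod_iff)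
    ultimately show ?thesis
      unfolding outer_copies_eq by (simp add: union_induce)
  qed
  ultimately show ?thesis
    by (rule digraph_iso_Res_prod)
qed

text \<open>If the distances in \<open>G\<close> are unbounded, both residual graphs are empty.\<close>

lemma Res_prod_res_dist_ge_3:
  assumes "3 \<le> res_dist G R_G"
  shows "digraph_iso (Res P R) (lexicographic_prod (Res G R_G) H)"
proof -
  let ?d = "res_dist G R_G"
  obtain y where y: "y \<in> verts H"
    using R_H_nonempty R_H_subset by blast
  have two: "2 < ?d"
    using assms by (cases ?d) (auto simp: numeral_eq_enat)
  then have one: "1 < ?d" and zero: "0 < ?d"
    by (cases ?d; simp add: numeral_eq_enat one_enat_def zero_enat_def)+
  \<comment> \<open>Suprema are compared through bounds at each vertex, because an infinite
    \<open>?d\<close> is attained nowhere in the connected graph \<open>G\<close>.\<close>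
  have "res_dist P R = ?d"
  proof (rule antisym)
    have "dP a \<le> ?d" if "a \<in> verts P" for a
      using that set_dist_le_res_dist[of _ G R_G] two one
      by (auto simp: set_dist_prod prod_dist_def min_le_iff_disj)
    then show "res_dist P R \<le> ?d"
      by (simp add: res_dist_eq_SUP[of P] SUP_le_iff)
    have "dG v \<le> res_dist P R" if "v \<in> verts G" for v
    proof (cases "v \<in> verts R_G")
      case True
      then show ?thesis
        using dG_eq_0_iff[of v] by simp
    next
      case False
      then have "dG v = dP (v, y)"
        using that y by (simp add: set_dist_prod prod_dist_def)
      also have "\<dots> \<le> res_dist P R"
        using that y by (intro set_dist_le_res_dist) auto
      finally show ?thesis .
    qed
    then show "?d \<le> res_dist P R"
      by (simp add: res_dist_eq_SUP[of G] SUP_le_iff)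
  qed
  moreover have "{a \<in> verts P. prod_dist a = ?d} = distance_class G (verts R_G) ?d \<times> verts H"
  proof -
    \<comment> \<open>Values over \<open>R_G\<close> are at most 2, so the level set of
      \<open>?d\<close> avoids those fibres.\<close>
    have "min 2 e \<noteq> ?d" for e
      using two by (auto simp: min_def)
    moreover have "v \<notin> verts R_G" if "dG v = ?d" for v
      using that zero dG_eq_0_iff[of v] by auto
    ultimately show ?thesis
      using one zero by (auto simp: prod_dist_def distance_class_def split: if_splits)
  qed
  moreover have "lexicographic_prod (Res G R_G) H = P \<restriction> (distance_class G (verts R_G) ?d \<times> verts H)"
    unfolding Res_def by (rule lexicographic_prod_induce_left) (auto simp: distance_class_def)
  ultimately show ?thesis
    by (rule digraph_iso_Res_prod)
qed

end

theorem theorem5: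
  fixes G R_G :: "('a, 'b) pre_digraph" and H R_H :: "('c, 'd) pre_digraph"
  assumes "simple_graph G" and "simple_graph H"
    and "is_root R_G G" and "is_root R_H H"
    and "connected G"
  shows
    "(res_dist G R_G = 1 \<and> res_dist H R_H \<noteq> 1 \<and> isolated_verts R_G \<noteq> {}
        \<and> verts R_H \<noteq> verts H \<longrightarrow>
      digraph_iso (Res (lexicographic_prod G H) (root_prod G R_G H R_H))
        (outer_copies G R_G H R_H)) \<and>
     (res_dist G R_G = 1 \<and> (res_dist H R_H = 1 \<or> isolated_verts R_G = {}) \<longrightarrow>
      digraph_iso (Res (lexicographic_prod G H) (root_prod G R_G H R_H))
        (del_verts (lexicographic_prod G H) (verts (root_prod G R_G H R_H)))) \<and>
     (res_dist G R_G = 2 \<longrightarrow>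
      digraph_iso (Res (lexicographic_prod G H) (root_prod G R_G H R_H))
        (union (lexicographic_prod (Res G R_G) H) (outer_copies G R_G H R_H))) \<and>
     (res_dist G R_G \<ge> 3 \<longrightarrow>
      digraph_iso (Res (lexicographic_prod G H) (root_prod G R_G H R_H))
        (lexicographic_prod (Res G R_G) H))"
proof (cases "verts R_G = verts G")
  \<comment> \<open>All distances from a spanning root are 0, which contradicts every premise on
    \<open>res_dist G R_G\<close>.\<close>
  case True
  interpret simple_graph G
    by (rule assms(1))
  have "set_dist G (verts R_G) v = 0" if "v \<in> verts G" for v
    using that True set_dist_eq_0_iff[of "verts R_G" v] by simp
  then have "res_dist G R_G \<le> 0"
    unfolding res_dist_eq_SUP by (intro SUP_least) simp
  then have "res_dist G R_G = 0"
    by simp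
  then show ?thesis
    by simp
next
  case False
  interpret rooted_lexicographic_prod G H R_G R_H
    using assms False by (simp add: rooted_lexicographic_prod_def rooted_lexicographic_prod_axioms_def)
  show ?thesis
    using Res_prod_res_dist_1_isolated Res_prod_res_dist_1_no_isolated Res_prod_res_dist_2
      Res_prod_res_dist_ge_3 by blast
qed

end
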